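(* Suppose $(\theta_{12},\theta_{13},\theta_{14},\theta_{23},\theta_{24},\theta_{34})$ is a $6$-tuple of numbers in $[0,\pi]$. Then the following statements are equivalent. (1) $(\theta_{12},\dots,\theta_{34})$ is the set of dihedral angles of a generalized Euclidean tetrahedron. (2) The Gram matrix $G$ of $(\theta_{12},\dots,\theta_{34})$ has signature $(3,0)$.
   Context: The Gram matrix of $(\theta_{12},\dots,\theta_{34})$ is the symmetric $4\times4$ matrix with diagonal entries $1$ and $(i,j)$ entry $-\cos\theta_{ij}$ for $i\ne j$. Signature $(p,q)$ means $p$ positive and $q$ negative eigenvalues (the remaining ones being zero). A generalized Euclidean tetrahedron is a quadruple of vectors $\mathbf u_1,\mathbf u_2,\mathbf u_3,\mathbf u_4$ in the unit sphere $\mathbb S^2$ of the Euclidean space $\mathbb E^3$ that span $\mathbb E^3$. Its dihedral angles are $\theta_{ij}=\pi-\cos^{-1}\langle\mathbf u_i,\mathbf u_j\rangle$, where $\langle\cdot,\cdot\rangle$ is the standard inner product on $\mathbb E^3$. *)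

theory Defs
  imports "HOL-Analysis.Analysis" "Jordan_Normal_Form.Char_Poly"
begin

text \<open>The rows and columns, in order, correspond to the indices \<open>1, 2, 3, 4\<close> of the angles.\<close>

definition gram_matrix :: "real \<Rightarrow> real \<Rightarrow> real \<Rightarrow> real \<Rightarrow> real \<Rightarrow> real \<Rightarrow> real mat" where
  "gram_matrix \<theta>12 \<theta>13 \<theta>14 \<theta>23 \<theta>24 \<theta>34 = mat_of_rows_list 4
     [[1,         - cos \<theta>12, - cos \<theta>13, - cos \<theta>14],
      [- cos \<theta>12, 1,         - cos \<theta>23, - cos \<theta>24],
      [- cos \<theta>13, - cos \<theta>23, 1,         - cos \<theta>34],
      [- cos \<theta>14, - cos \<theta>24, - cos \<theta>34, 1        ]]"

text \<open>Eigenvalues are counted with algebraic multiplicity, i.e. with their order as roots of the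
  characteristic polynomial. The definition is meant for real symmetric matrices, for which all
  roots of the characteristic polynomial are real.\<close>

definition signature :: "real mat \<Rightarrow> nat \<times> nat" where
  "signature A =
     ((\<Sum>x | eigenvalue A x \<and> x > 0. order x (char_poly A)),
      (\<Sum>x | eigenvalue A x \<and> x < 0. order x (char_poly A)))"

definition generalized_Euclidean_tetrahedron ::
  "real^3 \<Rightarrow> real^3 \<Rightarrow> real^3 \<Rightarrow> real^3 \<Rightarrow> bool" where
  "generalized_Euclidean_tetrahedron u1 u2 u3 u4 \<longleftrightarrow>
     {u1, u2, u3, u4} \<subseteq> sphere 0 1 \<and> span {u1, u2, u3, u4} = UNIV"

definition dihedral_angle :: "real^3 \<Rightarrow> real^3 \<Rightarrow> real" where
  "dihedral_angle u v = pi - arccos (inner u v)"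

end

theory Submission
  imports Defs
begin

text \<open>
  The characteristic polynomial of a real symmetric matrix has only real roots. Hence, for a
  symmetric matrix with unit diagonal and entries in \<open>[-1, 1]\<close>, the signs of the coefficients of
  the characteristic polynomial show that the signature is \<open>(3, 0)\<close> iff the determinant vanishes
  and the sum of the four principal \<open>3 \<times> 3\<close> minors is positive. For a Gram matrix of unit vectors
  in \<open>\<real>\<^sup>3\<close> the determinant is zero and these minors are squares of triple products, at least one
  of which is nonzero when the vectors span. Conversely, a positive principal minor yields three
  independent unit vectors in triangular form; the fourth vector is then determined by its inner
  products with these, and the vanishing of the determinant says that it has length 1.
\<close>

section \<open>Real-rootedness and signature of symmetric matrices\<close>

text \<open>A real symmetric matrix, viewed over the complex numbers, commutes with conjugation and
  can be moved across the Hermitian product. For an eigenvector \<open>v\<close> this turns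
  \<open>z * (v \<bullet>c v)\<close> into \<open>cnj z * (v \<bullet>c v)\<close>, and the factor
  \<open>v \<bullet>c v\<close> is nonzero.\<close>

lemma symmetric_eigenvalue_real:
  fixes A :: "real mat" and z :: complex
  assumes A: "A \<in> carrier_mat n n" and sym: "transpose_mat A = A"
    and ev: "eigenvalue (map_mat complex_of_real A) z"
  shows "z \<in> \<real>"
proof -
  let ?B = "map_mat complex_of_real A"
  have B: "?B \<in> carrier_mat n n"
    using A by simp
  have conjB: "conjugate (?B *\<^sub>v v) = ?B *\<^sub>v conjugate v" if "v \<in> carrier_vec n" for v
    using that A by (intro eq_vecI) (auto simp: scalar_prod_def sum_conjugate conjugate_dist_mul)
  obtain v where v: "v \<in> carrier_vec n" "v \<noteq> 0\<^sub>v n" and Bv: "?B *\<^sub>v v = z \<cdot>\<^sub>v v"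
    using ev A unfolding eigenvalue_def eigenvector_def by auto
  have tB: "transpose_mat ?B = ?B"
    using sym by (metis map_mat_transpose)
  have "z * (v \<bullet>c v) = scalar_prod (?B *\<^sub>v v) (conjugate v)"
    using v unfolding Bv by simp
  also have "\<dots> = scalar_prod v (?B *\<^sub>v conjugate v)"
    using transpose_vec_mult_scalar[OF B, of "conjugate v" v] v(1) unfolding tB by simp
  also have "\<dots> = scalar_prod v (conjugate (?B *\<^sub>v v))"
    using v by (simp add: conjB)
  also have "\<dots> = cnj z * (v \<bullet>c v)"
    using v unfolding Bv by (simp add: conjugate_smult_vec)
  finally show ?thesis
    using v by (simp add: Reals_cnj_iff)
qed

text \<open>Over the complex numbers the characteristic polynomial splits. Its roots are real, so
  the factorization is the image of a real one, and it descends because the embedding of real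
  polynomials is injective.\<close>

lemma symmetric_char_poly_splits:
  fixes A :: "real mat"
  assumes A: "A \<in> carrier_mat n n" and sym: "transpose_mat A = A"
  obtains as where "char_poly A = (\<Prod>a\<leftarrow>as. [:- a, 1:])" "length as = n"
proof -
  interpret poly_hom: map_poly_inj_idom_hom complex_of_real ..
  let ?B = "map_mat complex_of_real A"
  have B: "?B \<in> carrier_mat n n"
    using A by simp
  obtain cs where cs: "char_poly ?B = (\<Prod>c\<leftarrow>cs. [:- c, 1:])" "length cs = n"
    using char_poly_factorized[OF B] by blast
  have "c \<in> \<real>" if "c \<in> set cs" for c
  proof -
    have "poly (char_poly ?B) c = 0"
      using that unfolding cs by (auto simp: poly_prod_list prod_list_zero_iff)
    then show ?thesis
      using symmetric_eigenvalue_real[OF A sym] eigenvalue_root_char_poly[OF B] by blast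
  qed
  then have "map (complex_of_real \<circ> Re) cs = cs"
    by (intro map_idI) auto
  then have "char_poly ?B = (\<Prod>a\<leftarrow>map Re cs. [:- complex_of_real a, 1:])"
    by (metis (no_types, lifting) cs(1) map_map comp_def map_eq_conv)
  also have "\<dots> = map_poly complex_of_real (\<Prod>a\<leftarrow>map Re cs. [:- a, 1:])"
    by (simp add: poly_hom.hom_prod_list o_def)
  also have "char_poly ?B = map_poly complex_of_real (char_poly A)"
    by (rule of_real_hom.char_poly_hom[OF A])
  finally have "char_poly A = (\<Prod>a\<leftarrow>map Re cs. [:- a, 1:])"
    by simp
  then show thesis
    using that cs(2) by (metis length_map)
qed

lemma order_prod_list_linear:
  "order x (\<Prod>a\<leftarrow>as. [:- a, 1:]) = count_list as (x :: 'a :: field)"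
proof (induction as)
  case (Cons a as)
  have "[:- a, 1:] * (\<Prod>a\<leftarrow>as. [:- a, 1:]) \<noteq> 0"
    by (auto simp: prod_list_zero_iff simp del: mult_pCons_left)
  then have "order x (\<Prod>a\<leftarrow>a # as. [:- a, 1:]) =
      order x [:- a, 1:] + order x (\<Prod>a\<leftarrow>as. [:- a, 1:])"
    by (simp add: order_mult del: mult_pCons_left)
  then show ?case
    using Cons by (simp add: order_linear')
qed simp

text \<open>The order of a root is the number of its occurrences in \<open>as\<close>. Summing these
  orders over the roots of a given sign therefore counts the list entries of that sign.\<close>

lemma signature_of_split:
  assumes A: "A \<in> carrier_mat n n" and as: "char_poly A = (\<Prod>a\<leftarrow>as. [:- a, 1:])"
  shows "signature A = (length (filter (\<lambda>a. 0 < a) as), length (filter (\<lambda>a. a < 0) as))"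
proof -
  have ev: "eigenvalue A x \<longleftrightarrow> x \<in> set as" for x
    unfolding eigenvalue_root_char_poly[OF A] as
    by (auto simp: poly_prod_list prod_list_zero_iff)
  have "(\<Sum>x | eigenvalue A x \<and> P x. order x (char_poly A)) = length (filter P as)" for P
  proof -
    have "(\<Sum>x | eigenvalue A x \<and> P x. order x (char_poly A)) =
        (\<Sum>x\<in>set (filter P as). count_list (filter P as) x)"
      unfolding ev as order_prod_list_linear
      by (intro sum.cong) (auto simp: count_list_eq_length_filter intro: arg_cong[where f = length] filter_cong)
    then show ?thesis
      by (simp add: sum_count_set)
  qed
  then show ?thesis
    unfolding signature_def by simp
qed

section \<open>Explicit determinants up to order four\<close>

lemma det_2x2:
  fixes A :: "'a :: comm_ring_1 mat"
  assumes A: "A \<in> carrier_mat 2 2"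
  shows "Determinant.det A = A $$ (0,0) * A $$ (1,1) - A $$ (0,1) * A $$ (1,0)"
proof -
  have "Determinant.det (mat_delete A i j) = mat_delete A i j $$ (0,0)" for i j
    by (rule det_single) (use A in \<open>auto simp: mat_delete_def\<close>)
  then have "cofactor A i 0 = (-1) ^ i * mat_delete A i 0 $$ (0,0)" for i
    by (simp add: cofactor_def)
  moreover have "{..<2} = {0, 1::nat}" by auto
  ultimately show ?thesis
    using A by (subst laplace_expansion_column[OF A, of 0]) (auto simp: mat_delete_def)
qed

lemma det_3x3:
  fixes A :: "'a :: comm_ring_1 mat"
  assumes A: "A \<in> carrier_mat 3 3"
  shows "Determinant.det A =
    A $$ (0,0) * (A $$ (1,1) * A $$ (2,2) - A $$ (1,2) * A $$ (2,1))
  - A $$ (1,0) * (A $$ (0,1) * A $$ (2,2) - A $$ (0,2) * A $$ (2,1))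
  + A $$ (2,0) * (A $$ (0,1) * A $$ (1,2) - A $$ (0,2) * A $$ (1,1))"
proof -
  have "cofactor A i 0 = (-1) ^ i * (mat_delete A i 0 $$ (0,0) * mat_delete A i 0 $$ (1,1)
      - mat_delete A i 0 $$ (0,1) * mat_delete A i 0 $$ (1,0))" for i
    unfolding cofactor_def by (subst det_2x2) (use A in \<open>auto simp: mat_delete_def\<close>)
  then show ?thesis
    using A by (subst laplace_expansion_column[OF A, of 0])
      (simp_all add: mat_delete_def eval_nat_numeral lessThan_Suc, simp_all add: algebra_simps)
qed

text \<open>Laplace expansion along the first column. Commutative rings are allowed because the
  formula is applied both to real matrices and to the polynomial matrix that defines
  \<open>char_poly\<close>.\<close>

lemma det_4x4:
  fixes A :: "'a :: comm_ring_1 mat"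
  assumes A: "A \<in> carrier_mat 4 4"
  shows "Determinant.det A =
    A $$ (0,0) * (A $$ (1,1) * (A $$ (2,2) * A $$ (3,3) - A $$ (2,3) * A $$ (3,2))
                - A $$ (2,1) * (A $$ (1,2) * A $$ (3,3) - A $$ (1,3) * A $$ (3,2))
                + A $$ (3,1) * (A $$ (1,2) * A $$ (2,3) - A $$ (1,3) * A $$ (2,2)))
  - A $$ (1,0) * (A $$ (0,1) * (A $$ (2,2) * A $$ (3,3) - A $$ (2,3) * A $$ (3,2))
                - A $$ (2,1) * (A $$ (0,2) * A $$ (3,3) - A $$ (0,3) * A $$ (3,2))
                + A $$ (3,1) * (A $$ (0,2) * A $$ (2,3) - A $$ (0,3) * A $$ (2,2)))
  + A $$ (2,0) * (A $$ (0,1) * (A $$ (1,2) * A $$ (3,3) - A $$ (1,3) * A $$ (3,2))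
                - A $$ (1,1) * (A $$ (0,2) * A $$ (3,3) - A $$ (0,3) * A $$ (3,2))
                + A $$ (3,1) * (A $$ (0,2) * A $$ (1,3) - A $$ (0,3) * A $$ (1,2)))
  - A $$ (3,0) * (A $$ (0,1) * (A $$ (1,2) * A $$ (2,3) - A $$ (1,3) * A $$ (2,2))
                - A $$ (1,1) * (A $$ (0,2) * A $$ (2,3) - A $$ (0,3) * A $$ (2,2))
                + A $$ (2,1) * (A $$ (0,2) * A $$ (1,3) - A $$ (0,3) * A $$ (1,2)))"
proof -
  let ?D = "\<lambda>i. mat_delete A i 0"
  have D: "?D i \<in> carrier_mat 3 3" for i
    using A by (auto simp: mat_delete_def)
  have cof: "cofactor A i 0 = (-1) ^ i * (
      ?D i $$ (0,0) * (?D i $$ (1,1) * ?D i $$ (2,2) - ?D i $$ (1,2) * ?D i $$ (2,1))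
    - ?D i $$ (1,0) * (?D i $$ (0,1) * ?D i $$ (2,2) - ?D i $$ (0,2) * ?D i $$ (2,1))
    + ?D i $$ (2,0) * (?D i $$ (0,1) * ?D i $$ (1,2) - ?D i $$ (0,2) * ?D i $$ (1,1)))" for i
    unfolding cofactor_def by (subst det_3x3[OF D]) auto
  have entry: "?D i $$ (j,k) = A $$ (if j < i then j else Suc j, Suc k)" if "j < 3" "k < 3" for i j k
    using A that by (auto simp: mat_delete_def)
  have "Determinant.det A = A $$ (0,0) * cofactor A 0 0 + A $$ (1,0) * cofactor A 1 0
      + A $$ (2,0) * cofactor A 2 0 + A $$ (3,0) * cofactor A 3 0"
    by (subst laplace_expansion_column[OF A, of 0]) (simp_all add: eval_nat_numeral lessThan_Suc)
  then show ?thesis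
    unfolding cof
    by (simp add: entry flip: numeral_2_eq_2 numeral_3_eq_3) (simp add: algebra_simps)
qed

section \<open>Signature (3, 0) as a condition on principal minors\<close>

lemma mat_of_rows_list_4_carrier [simp]:
  "mat_of_rows_list 4 [r1, r2, r3, r4] \<in> carrier_mat 4 4"
  by (rule carrier_matI) (simp_all add: mat_of_rows_list_def)

text \<open>The conditions concern the elementary symmetric functions of the roots. Nonnegative
  first, second and third ones exclude negative roots. A zero product then gives a root 0, and a
  second root 0 would make the third symmetric function vanish.\<close>

lemma three_positive_one_zero_root_iff:
  fixes p q r s :: real
  assumes e1: "p + q + r + s > 0"
    and e2: "p * q + p * r + p * s + q * r + q * s + r * s \<ge> 0"
  shows "(length (filter (\<lambda>a. 0 < a) [p, q, r, s]) = 3 \<and> length (filter (\<lambda>a. a < 0) [p, q, r, s]) = 0)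
    \<longleftrightarrow> p * q * r * s = 0 \<and> p * q * r + p * q * s + p * r * s + q * r * s > 0"
    (is "?L \<longleftrightarrow> ?R")
proof
  assume ?L
  then consider "p = 0" "q > 0" "r > 0" "s > 0" | "p > 0" "q = 0" "r > 0" "s > 0"
    | "p > 0" "q > 0" "r = 0" "s > 0" | "p > 0" "q > 0" "r > 0" "s = 0"
    by (auto split: if_splits)
  then show ?R
    by cases simp_all
next
  assume R: ?R
  have "x \<ge> 0" if "x \<in> {p, q, r, s}" for x
  proof (rule ccontr)
    assume "\<not> x \<ge> 0"
    then have x: "x < 0" by simp
    \<comment> \<open>At a negative \<open>x\<close> every signed term of the expanded quartic is
      nonnegative and \<open>x ^ 4\<close> is positive, so the quartic cannot vanish there.\<close>
    have "(x - p) * (x - q) * (x - r) * (x - s) = 0"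
      using that by auto
    then have "x ^ 4 - (p + q + r + s) * x ^ 3
        + (p * q + p * r + p * s + q * r + q * s + r * s) * x\<^sup>2
        - (p * q * r + p * q * s + p * r * s + q * r * s) * x + p * q * r * s = 0"
      by (simp add: algebra_simps eval_nat_numeral)
    moreover have "x ^ 4 > 0" "(p + q + r + s) * x ^ 3 \<le> 0"
      "(p * q + p * r + p * s + q * r + q * s + r * s) * x\<^sup>2 \<ge> 0"
      "(p * q * r + p * q * s + p * r * s + q * r * s) * x \<le> 0"
      using x e1 e2 R by (auto simp: mult_nonneg_nonpos power_less_zero_eq less_imp_le)
    ultimately show False
      using R by linarith
  qed
  then have "p \<ge> 0" "q \<ge> 0" "r \<ge> 0" "s \<ge> 0"
    by auto
  then show ?L
    using R by auto
qed

text \<open>The parameters are the entries above the diagonal, row by row.\<close>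

definition gram_det3 :: "real \<Rightarrow> real \<Rightarrow> real \<Rightarrow> real" where
  "gram_det3 a b d = 1 + 2 * a * b * d - a\<^sup>2 - b\<^sup>2 - d\<^sup>2"

definition gram_det4 :: "real \<Rightarrow> real \<Rightarrow> real \<Rightarrow> real \<Rightarrow> real \<Rightarrow> real \<Rightarrow> real" where
  "gram_det4 a b c d e f = 1 - a\<^sup>2 - b\<^sup>2 - c\<^sup>2 - d\<^sup>2 - e\<^sup>2 - f\<^sup>2
     + a\<^sup>2 * f\<^sup>2 + b\<^sup>2 * e\<^sup>2 + c\<^sup>2 * d\<^sup>2
     + 2 * a * b * d + 2 * a * c * e + 2 * b * c * f + 2 * d * e * f
     - 2 * a * b * e * f - 2 * a * c * d * f - 2 * b * c * d * e"

abbreviation unit_gram_mat :: "real \<Rightarrow> real \<Rightarrow> real \<Rightarrow> real \<Rightarrow> real \<Rightarrow> real \<Rightarrow> real mat" where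
  "unit_gram_mat a b c d e f \<equiv>
     mat_of_rows_list 4 [[1, a, b, c], [a, 1, d, e], [b, d, 1, f], [c, e, f, 1]]"

text \<open>Up to sign, the coefficients are the sums of the principal minors of each order. Both
  sides are compared as functions of a real \<open>x\<close>, which suffices for real
  polynomials.\<close>

lemma char_poly_unit_gram_mat:
  "char_poly (unit_gram_mat a b c d e f) =
    [: gram_det4 a b c d e f,
       - (gram_det3 a b d + gram_det3 a c e + gram_det3 b c f + gram_det3 d e f),
       6 - a\<^sup>2 - b\<^sup>2 - c\<^sup>2 - d\<^sup>2 - e\<^sup>2 - f\<^sup>2, - 4, 1 :]"
proof -
  have "poly (char_poly (unit_gram_mat a b c d e f)) x =
    poly [: gram_det4 a b c d e f,
       - (gram_det3 a b d + gram_det3 a c e + gram_det3 b c f + gram_det3 d e f),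
       6 - a\<^sup>2 - b\<^sup>2 - c\<^sup>2 - d\<^sup>2 - e\<^sup>2 - f\<^sup>2, - 4, 1 :] x" for x
  proof -
    let ?G = "unit_gram_mat a b c d e f"
    have entry: "poly (char_poly_matrix ?G $$ (i, j)) x =
        (if i = j then x else 0) - ?G $$ (i, j)" if "i < 4" "j < 4" for i j
      using that by (simp add: char_poly_matrix_def mat_of_rows_list_def)
    show ?thesis
      unfolding char_poly_def det_4x4[OF char_poly_matrix_closed[OF mat_of_rows_list_4_carrier]]
        poly_add poly_diff poly_mult
      by (simp add: entry)
        (simp add: mat_of_rows_list_def gram_det3_def gram_det4_def algebra_simps power2_eq_square)
  qed
  then show ?thesis
    by (simp add: poly_eq_poly_eq_iff[symmetric] fun_eq_iff)
qed

lemma signature_unit_gram_mat_eq: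
  assumes "\<bar>a\<bar> \<le> 1" "\<bar>b\<bar> \<le> 1" "\<bar>c\<bar> \<le> 1" "\<bar>d\<bar> \<le> 1" "\<bar>e\<bar> \<le> 1" "\<bar>f\<bar> \<le> 1"
  shows "signature (unit_gram_mat a b c d e f) = (3, 0) \<longleftrightarrow>
    gram_det4 a b c d e f = 0 \<and>
    gram_det3 a b d + gram_det3 a c e + gram_det3 b c f + gram_det3 d e f > 0"
proof -
  let ?G = "unit_gram_mat a b c d e f"
  have G: "?G \<in> carrier_mat 4 4"
    by simp
  have sym: "transpose_mat ?G = ?G"
    by (rule eq_matI) (auto simp: mat_of_rows_list_def less_Suc_eq numeral_eq_Suc)
  obtain as where as: "char_poly ?G = (\<Prod>x\<leftarrow>as. [:- x, 1:])" "length as = 4"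
    using symmetric_char_poly_splits[OF G sym] .
  then obtain p q r s where pqrs: "as = [p, q, r, s]"
    by (auto simp: numeral_eq_Suc length_Suc_conv)
  \<comment> \<open>Vieta's formulas. The bounds on the entries make the second symmetric function
    nonnegative.\<close>
  have coeffs: "p + q + r + s = 4"
    "p * q + p * r + p * s + q * r + q * s + r * s = 6 - a\<^sup>2 - b\<^sup>2 - c\<^sup>2 - d\<^sup>2 - e\<^sup>2 - f\<^sup>2"
    "p * q * r + p * q * s + p * r * s + q * r * s =
      gram_det3 a b d + gram_det3 a c e + gram_det3 b c f + gram_det3 d e f"
    "p * q * r * s = gram_det4 a b c d e f"
    using as(1) unfolding char_poly_unit_gram_mat pqrs by (simp_all add: algebra_simps)
  have "a\<^sup>2 \<le> 1" "b\<^sup>2 \<le> 1" "c\<^sup>2 \<le> 1" "d\<^sup>2 \<le> 1" "e\<^sup>2 \<le> 1" "f\<^sup>2 \<le> 1"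
    using assms by (simp_all add: abs_square_le_1)
  then show ?thesis
    unfolding signature_of_split[OF G as(1)] pqrs prod.inject
    by (subst three_positive_one_zero_root_iff) (simp_all add: coeffs)
qed

section \<open>Triple products and Gram determinants in three-space\<close>

text \<open>The triple product is the determinant of the matrix with rows \<open>x\<close>,
  \<open>y\<close>, \<open>z\<close>, and this matrix is invertible iff its rows span.\<close>

lemma span_triple_UNIV_iff:
  fixes x y z :: "real^3"
  shows "span {x, y, z} = UNIV \<longleftrightarrow> inner x (cross3 y z) \<noteq> 0"
proof -
  have "Finite_Cartesian_Product.rows (vector [x, y, z] :: real^3^3) = {x, y, z}"
    unfolding Finite_Cartesian_Product.rows_def Finite_Cartesian_Product.row_def
      vec_lambda_eta setcompr_eq_image UNIV_3 Collect_mem_eq image_insert image_empty vector_3 ..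
  then show ?thesis
    unfolding dot_cross_det invertible_det_nz[symmetric] invertible_left_inverse
      matrix_left_invertible_span_rows by simp
qed

lemma triple_product_square:
  fixes x y z :: "real^3"
  assumes "norm x = 1" "norm y = 1" "norm z = 1"
  shows "(inner x (cross3 y z))\<^sup>2 = gram_det3 (inner x y) (inner x z) (inner y z)"
proof -
  have "(inner x (cross3 y z))\<^sup>2 = inner x x * inner y y * inner z z
      + 2 * inner x y * inner x z * inner y z
      - inner z z * (inner x y)\<^sup>2 - inner y y * (inner x z)\<^sup>2 - inner x x * (inner y z)\<^sup>2"
    by (simp add: cross3_simps power2_eq_square)
  then show ?thesis
    using assms by (simp add: gram_det3_def norm_eq_1)
qed

lemma span_four_UNIV_triple:
  fixes u1 u2 u3 u4 :: "real^3"
  assumes "span {u1, u2, u3, u4} = UNIV"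
  shows "span {u1, u2, u3} = UNIV \<or> span {u1, u2, u4} = UNIV \<or>
    span {u1, u3, u4} = UNIV \<or> span {u2, u3, u4} = UNIV"
proof -
  obtain B where B: "B \<subseteq> {u1, u2, u3, u4}" "{u1, u2, u3, u4} \<subseteq> span B"
      "card B = dim {u1, u2, u3, u4}"
    using basis_exists by metis
  have spanB: "span B = UNIV"
    using B(2) assms span_minimal[OF B(2)] by auto
  have "card B = 3"
    using B(3) dim_span[of "{u1, u2, u3, u4}"] unfolding assms by simp
  have "B \<subseteq> {u1, u2, u3} \<or> B \<subseteq> {u1, u2, u4} \<or> B \<subseteq> {u1, u3, u4} \<or> B \<subseteq> {u2, u3, u4}"
  proof (rule ccontr)
    assume not: "\<not> ?thesis"
    then have B_eq: "B = {u1, u2, u3, u4}"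
      using B(1) by blast
    \<comment> \<open>A basis meeting all four vectors forces a repetition among them, as it has
      only three elements. Dropping a repeated vector then leaves a triple that still contains the
      basis.\<close>
    then have "\<not> distinct [u1, u2, u3, u4]"
      using \<open>card B = 3\<close> distinct_card[of "[u1, u2, u3, u4]"] by auto
    then show False
      using not B_eq by auto
  qed
  moreover have "span T = UNIV" if "B \<subseteq> T" for T
    using span_mono[OF that] spanB by auto
  ultimately show ?thesis
    by metis
qed

text \<open>The determinant is affine in the last diagonal entry, with slope the complementary \<open>3 \<times> 3\<close>
  minor, and it vanishes when that entry is \<open>inner t t\<close> instead of \<open>1\<close>.\<close>

lemma gram_det4_eq:
  fixes u v w t :: "real^3"
  assumes "norm u = 1" "norm v = 1" "norm w = 1"
  shows "gram_det4 (inner u v) (inner u w) (inner u t) (inner v w) (inner v t) (inner w t) =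
    (1 - inner t t) * gram_det3 (inner u v) (inner u w) (inner v w)"
proof -
  \<comment> \<open>Padding with a zero coordinate makes the matrix of the four vectors square with
    a zero column, so the product with its transpose, the Gram matrix \<open>?G\<close>, is
    singular.\<close>
  let ?r = "\<lambda>x :: real^3. [x $ 1, x $ 2, x $ 3, 0]"
  let ?M = "mat_of_rows_list 4 [?r u, ?r v, ?r w, ?r t]"
  let ?G = "mat_of_rows_list 4
    [[inner u u, inner u v, inner u w, inner u t], [inner v u, inner v v, inner v w, inner v t],
     [inner w u, inner w v, inner w w, inner w t], [inner t u, inner t v, inner t w, inner t t]]"
  have M: "?M \<in> carrier_mat 4 4" and G: "?G \<in> carrier_mat 4 4"
    by simp_all
  have "Determinant.det ?M = 0"
    by (subst det_4x4[OF M]) (simp add: mat_of_rows_list_def)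
  moreover have "?G = ?M * transpose_mat ?M"
    by (rule eq_matI) (auto simp: mat_of_rows_list_def less_Suc_eq numeral_eq_Suc
      scalar_prod_def inner_vec_def sum_3[unfolded numeral_eq_Suc])
  ultimately have "Determinant.det ?G = 0"
    using M by (simp add: Determinant.det_mult[OF M])
  moreover have "inner u u = 1" "inner v v = 1" "inner w w = 1"
    using assms by (simp_all add: norm_eq_1)
  ultimately show ?thesis
    unfolding det_4x4[OF G]
    by (simp add: mat_of_rows_list_def inner_commute gram_det4_def gram_det3_def algebra_simps power2_eq_square)
qed

section \<open>Vectors with prescribed inner products\<close>

text \<open>This is a Cholesky factorization: \<open>u\<close>, \<open>v\<close>, \<open>w\<close>
  are the rows of a lower triangular matrix with positive diagonal, and the coordinates of
  \<open>t\<close> follow by forward substitution.\<close>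

lemma unit_vectors_of_gram:
  assumes a: "\<bar>a\<bar> \<le> 1" and D: "gram_det3 a b d > 0" and det0: "gram_det4 a b c d e f = 0"
  obtains u v w t :: "real^3"
  where "norm u = 1" "norm v = 1" "norm w = 1" "norm t = 1" "span {u, v, w} = UNIV"
    "inner u v = a" "inner u w = b" "inner u t = c" "inner v w = d" "inner v t = e" "inner w t = f"
proof -
  \<comment> \<open>Written this way, the minor could not be positive if
    \<open>a\<^sup>2 = 1\<close>. Hence the pivot \<open>1 - a\<^sup>2\<close> is positive.\<close>
  have D_eq: "gram_det3 a b d = (1 - a\<^sup>2) * (1 - b\<^sup>2) - (d - a * b)\<^sup>2"
    by (simp add: gram_det3_def algebra_simps power2_eq_square)
  have "a\<^sup>2 \<noteq> 1"
    using D D_eq by auto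
  then have a2: "a\<^sup>2 < 1"
    using a by (simp add: abs_square_le_1 order.not_eq_order_implies_strict)
  \<comment> \<open>The diagonal entries \<open>s\<close> and \<open>k\<close> are the ones that
    give \<open>v\<close> and \<open>w\<close> length 1; \<open>k\<^sup>2\<close> is the ratio of
    consecutive leading minors.\<close>
  define s where "s = sqrt (1 - a\<^sup>2)"
  define k where "k = sqrt (gram_det3 a b d) / s"
  have s: "s > 0" "s\<^sup>2 = 1 - a\<^sup>2"
    using a2 by (simp_all add: s_def)
  have k: "k > 0" "k\<^sup>2 = gram_det3 a b d / s\<^sup>2"
    using s D by (simp_all add: k_def power_divide)
  \<comment> \<open>These three values solve \<open>inner v w = d\<close>,
    \<open>inner v t = e\<close> and \<open>inner w t = f\<close> in turn.\<close>
  define q where "q = (d - a * b) / s"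
  define y where "y = (e - a * c) / s"
  define z where "z = (f - b * c - q * y) / k"
  define u v w t :: "real^3" where
    "u = vector [1, 0, 0]" and "v = vector [a, s, 0]" and "w = vector [b, q, k]"
    and "t = vector [c, y, z]"
  note coords = u_def v_def w_def t_def inner_vec_def sum_3 vector_3
  have "k\<^sup>2 = 1 - b\<^sup>2 - q\<^sup>2"
    using s unfolding k(2) D_eq q_def s(2)[symmetric] by (simp add: field_simps)
  then have norms: "norm u = 1" "norm v = 1" "norm w = 1"
    using s(2) by (simp_all add: norm_eq_1 coords power2_eq_square[symmetric])
  have inners: "inner u v = a" "inner u w = b" "inner u t = c" "inner v w = d" "inner v t = e"
      "inner w t = f"
    using s(1) k(1) by (simp_all add: coords q_def y_def z_def)
  have "(1 - inner t t) * gram_det3 a b d = 0"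
    using gram_det4_eq[OF norms, of t] unfolding inners det0 by simp
  then have "norm t = 1"
    using D by (simp add: norm_eq_1)
  moreover have "span {u, v, w} = UNIV"
    using triple_product_square[OF norms] D unfolding span_triple_UNIV_iff inners by auto
  ultimately show thesis
    using that norms inners by blast
qed

section \<open>Dihedral angles and the equivalence\<close>

text \<open>For unit vectors the inner product lies in \<open>[-1, 1]\<close>, where
  \<open>cos\<close> undoes \<open>arccos\<close>; on \<open>{0..pi}\<close> \<open>arccos\<close>
  undoes \<open>cos\<close>. Prescribing angles thus means prescribing inner products.\<close>

lemma eq_dihedral_angle_iff:
  assumes "norm u = 1" "norm v = 1" "\<theta> \<in> {0..pi}"
  shows "\<theta> = dihedral_angle u v \<longleftrightarrow> inner u v = - cos \<theta>"
proof -
  have "\<bar>inner u v\<bar> \<le> 1"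
    using Cauchy_Schwarz_ineq2[of u v] assms by simp
  then have "cos (dihedral_angle u v) = - inner u v"
    by (simp add: dihedral_angle_def cos_diff cos_arccos_abs)
  moreover have "arccos (- cos \<theta>) = pi - \<theta>"
    using arccos_cos[of "pi - \<theta>"] assms(3) by (simp add: cos_diff)
  ultimately show ?thesis
    unfolding dihedral_angle_def by auto
qed

theorem theorem4p6:
  fixes \<theta>12 \<theta>13 \<theta>14 \<theta>23 \<theta>24 \<theta>34 :: real
  assumes "{\<theta>12, \<theta>13, \<theta>14, \<theta>23, \<theta>24, \<theta>34} \<subseteq> {0..pi}"
  shows "(\<exists>u1 u2 u3 u4.
            generalized_Euclidean_tetrahedron u1 u2 u3 u4 \<and>
            \<theta>12 = dihedral_angle u1 u2 \<and> \<theta>13 = dihedral_angle u1 u3 \<and>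
            \<theta>14 = dihedral_angle u1 u4 \<and> \<theta>23 = dihedral_angle u2 u3 \<and>
            \<theta>24 = dihedral_angle u2 u4 \<and> \<theta>34 = dihedral_angle u3 u4)
         \<longleftrightarrow> signature (gram_matrix \<theta>12 \<theta>13 \<theta>14 \<theta>23 \<theta>24 \<theta>34) = (3, 0)"
    (is "?L \<longleftrightarrow> ?R")
proof -
  define a b c d e f where "a = - cos \<theta>12" and "b = - cos \<theta>13" and "c = - cos \<theta>14"
    and "d = - cos \<theta>23" and "e = - cos \<theta>24" and "f = - cos \<theta>34"
  note defs = a_def b_def c_def d_def e_def f_def
  have le1: "\<bar>a\<bar> \<le> 1" "\<bar>b\<bar> \<le> 1" "\<bar>c\<bar> \<le> 1" "\<bar>d\<bar> \<le> 1" "\<bar>e\<bar> \<le> 1" "\<bar>f\<bar> \<le> 1"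
    by (simp_all add: defs)
  let ?P = "\<lambda>u1 u2 u3 u4 :: real^3.
    norm u1 = 1 \<and> norm u2 = 1 \<and> norm u3 = 1 \<and> norm u4 = 1 \<and> span {u1, u2, u3, u4} = UNIV \<and>
    inner u1 u2 = a \<and> inner u1 u3 = b \<and> inner u1 u4 = c \<and>
    inner u2 u3 = d \<and> inner u2 u4 = e \<and> inner u3 u4 = f"
  have "?L \<longleftrightarrow> (\<exists>u1 u2 u3 u4. ?P u1 u2 u3 u4)"
    unfolding generalized_Euclidean_tetrahedron_def defs
    using assms by (simp add: eq_dihedral_angle_iff conj_assoc cong: conj_cong)
  also have "\<dots> \<longleftrightarrow> gram_det4 a b c d e f = 0 \<and>
      gram_det3 a b d + gram_det3 a c e + gram_det3 b c f + gram_det3 d e f > 0"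
      (is "_ \<longleftrightarrow> ?det4 = 0 \<and> ?S > 0")
  proof
    assume "\<exists>u1 u2 u3 u4. ?P u1 u2 u3 u4"
    then obtain u1 u2 u3 u4 where P: "?P u1 u2 u3 u4"
      by blast
    then have "?det4 = 0"
      using gram_det4_eq[of u1 u2 u3 u4] by (simp add: norm_eq_1)
    moreover have sq: "gram_det3 a b d = (inner u1 (cross3 u2 u3))\<^sup>2"
      "gram_det3 a c e = (inner u1 (cross3 u2 u4))\<^sup>2"
      "gram_det3 b c f = (inner u1 (cross3 u3 u4))\<^sup>2"
      "gram_det3 d e f = (inner u2 (cross3 u3 u4))\<^sup>2"
      using P by (simp_all add: triple_product_square)
    have "inner u1 (cross3 u2 u3) \<noteq> 0 \<or> inner u1 (cross3 u2 u4) \<noteq> 0 \<or>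
        inner u1 (cross3 u3 u4) \<noteq> 0 \<or> inner u2 (cross3 u3 u4) \<noteq> 0"
      using P span_four_UNIV_triple[of u1 u2 u3 u4] unfolding span_triple_UNIV_iff by blast
    then have "?S > 0"
      unfolding sq by (smt (verit) zero_le_power2 zero_less_power2)
    ultimately show "?det4 = 0 \<and> ?S > 0" ..
  next
    assume S: "?det4 = 0 \<and> ?S > 0"
    then consider "gram_det3 a b d > 0" | "gram_det3 a c e > 0" | "gram_det3 b c f > 0"
      | "gram_det3 d e f > 0"
      by linarith
    then show "\<exists>u1 u2 u3 u4. ?P u1 u2 u3 u4"
    proof cases
      case 1
      obtain u v w t :: "real^3" where *: "norm u = 1" "norm v = 1" "norm w = 1" "norm t = 1"
        "span {u, v, w} = UNIV"
        "inner u v = a" "inner u w = b" "inner u t = c" "inner v w = d" "inner v t = e" "inner w t = f"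
        using unit_vectors_of_gram[OF le1(1) 1] S by metis
      moreover have "span {u, v, w, t} = UNIV"
        using span_mono[of "{u, v, w}" "{u, v, w, t}"] *(5) by auto
      ultimately show ?thesis
        by blast
    next
      case 2
      \<comment> \<open>Permuting rows and columns simultaneously preserves the determinant. The
        order 1, 2, 4, 3 makes the positive minor the leading one.\<close>
      have "gram_det4 a c b e d f = 0"
        using S by (simp add: gram_det4_def algebra_simps)
      then obtain u v w t :: "real^3" where *: "norm u = 1" "norm v = 1" "norm w = 1" "norm t = 1"
        "span {u, v, w} = UNIV"
        "inner u v = a" "inner u w = c" "inner u t = b" "inner v w = e" "inner v t = d" "inner w t = f"
        using unit_vectors_of_gram[OF le1(1) 2] by metis
      moreover have "span {u, v, t, w} = UNIV"
        using span_mono[of "{u, v, w}" "{u, v, t, w}"] *(5) by auto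
      ultimately have "?P u v t w"
        by (simp add: inner_commute)
      then show ?thesis
        by blast
    next
      case 3
      \<comment> \<open>Here the vectors are taken in the order 1, 3, 4, 2.\<close>
      have "gram_det4 b c a f d e = 0"
        using S by (simp add: gram_det4_def algebra_simps)
      then obtain u v w t :: "real^3" where *: "norm u = 1" "norm v = 1" "norm w = 1" "norm t = 1"
        "span {u, v, w} = UNIV"
        "inner u v = b" "inner u w = c" "inner u t = a" "inner v w = f" "inner v t = d" "inner w t = e"
        using unit_vectors_of_gram[OF le1(2) 3] by metis
      moreover have "span {u, t, v, w} = UNIV"
        using span_mono[of "{u, v, w}" "{u, t, v, w}"] *(5) by auto
      ultimately have "?P u t v w"
        by (simp add: inner_commute)
      then show ?thesis
        by blast
    next
      case 4
      \<comment> \<open>Here the vectors are taken in the order 2, 3, 4, 1.\<close>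
      have "gram_det4 d e a f b c = 0"
        using S by (simp add: gram_det4_def algebra_simps)
      then obtain u v w t :: "real^3" where *: "norm u = 1" "norm v = 1" "norm w = 1" "norm t = 1"
        "span {u, v, w} = UNIV"
        "inner u v = d" "inner u w = e" "inner u t = a" "inner v w = f" "inner v t = b" "inner w t = c"
        using unit_vectors_of_gram[OF le1(4) 4] by metis
      moreover have "span {t, u, v, w} = UNIV"
        using span_mono[of "{u, v, w}" "{t, u, v, w}"] *(5) by auto
      ultimately have "?P t u v w"
        by (simp add: inner_commute)
      then show ?thesis
        by blast
    qed
  qed
  also have "\<dots> \<longleftrightarrow> ?R"
    using signature_unit_gram_mat_eq[OF le1] by (simp add: gram_matrix_def defs)
  finally show ?thesis .
qed

end
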